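(* Fix a positive real number $N$. Let $k$ be a large integer, let $M$ be a positive integer, let $\mathbf u\in(\mathbb R/\mathbb Z)^k$ satisfy $M\mathbf u\in\mathbb Z^k$, and let $n$ be a positive divisor of $M$. Then either (i) there exists a non-zero vector $\mathbf r\in\mathbb Z^k$ such that $|r_j|\le k^4N\log^2 N$ for all $j\le k$ and $n(\mathbf r\cdot\mathbf u)\equiv0\pmod 1$; or (ii) $\#C_{n^-}\!\left(\tfrac2N,k\right)\ge\frac{M}{nN^k}$.
   Context: For $x\in\mathbb R/\mathbb Z$, $|x|$ denotes the distance to the nearest integer, and $(\ell\mathbf u)_j$ is the $j$-th component of $\ell\mathbf u$. For $\eta>0$ define $C_{n^-}(\eta,k)=\{0\le\ell\le M-1:\ \ell\not\equiv0\pmod n,\ |(\ell\mathbf u)_j|\le\eta\text{ for }1\le j\le k\}$.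
   Formalization: The formal theorem assumes N ≥ 1 and n ≥ 2: for n = 1 the set C is empty and for 0 < N < 1 with n = 2 the count is at most M/2 < M/(nN^k), so (ii) fails, while (i) fails for u_j = T^j/M with T and M large. "Large k" means k ≥ k₀(N). *)

theory Defs
  imports Complex_Main "HOL-Number_Theory.Cong"
begin

text \<open>
  A point of \<open>(\<real>/\<int>)\<^sup>k\<close> is represented by a real-valued function on the indices \<open>1..k\<close>, i.e. by
  an arbitrary choice of representatives; everything below is invariant under shifting these by
  integers, and values at indices outside \<open>1..k\<close> are never used.
\<close>

definition dist_nearest_int :: "real \<Rightarrow> real" where
  "dist_nearest_int x = \<bar>x - of_int (round x)\<bar>"

definition C_minus :: "nat \<Rightarrow> (nat \<Rightarrow> real) \<Rightarrow> nat \<Rightarrow> real \<Rightarrow> nat \<Rightarrow> nat set" where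
  "C_minus M u n \<eta> k =
     {l. l < M \<and> \<not> [l = 0] (mod n) \<and> (\<forall>j\<in>{1..k}. dist_nearest_int (real l * u j) \<le> \<eta>)}"

end

theory Submission
  imports Defs "HOL-Analysis.Weierstrass_Theorems" "HOL-Computational_Algebra.Polynomial"
begin

text \<open>
  For \<open>N \<le> 4\<close> the constraint defining \<open>C_minus\<close> is void. For \<open>N > 4\<close> let \<open>F(x)\<close> be the probability
  that a binomial variable with parameters \<open>D = k\<^sup>2\<close> and \<open>cos\<^sup>2(\<pi>x)\<close> is at least \<open>D t\<^sub>0\<close>. This is a
  trigonometric polynomial of degree at most \<open>D\<close> with values in \<open>[0,1]\<close>, and for a suitable threshold
  \<open>t\<^sub>0\<close> Chebyshev's inequality makes it \<open>O(1/D)\<close> outside \<open>|x| \<le> 2/N\<close> and \<open>1 - O(1/D)\<close> on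
  \<open>|x| \<le> 7/(4N)\<close>; hence its mean \<open>c\<close> is at least \<open>3/(2N)\<close> for large \<open>k\<close>. If (i) fails, no frequency of
  degree at most \<open>D\<close> other than \<open>0\<close> contributes to the sum of \<open>\<Prod>\<^sub>j F(l u\<^sub>j)\<close> over the \<open>l\<close> not divisible by
  \<open>n\<close>, which is therefore exactly \<open>(M - M/n) c\<^sup>k\<close>, and likewise for products over fewer indices. An \<open>l\<close>
  outside \<open>C_minus\<close> has one factor of size \<open>O(1/D)\<close>, so all such \<open>l\<close> together contribute at most
  \<open>k O(1/D) (M - M/n) c\<^bsup>k-1\<^esup>\<close>, less than half of the total.
\<close>

section \<open>Exponential sums over multiples and non-multiples of \<open>n\<close>\<close>

text \<open>A geometric sum whose ratio \<open>cis (2 * pi * \<theta>)\<close> is an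
  \<open>M\<close>-th root of unity, so it vanishes unless the ratio is 1.\<close>

lemma sum_cis_multiples:
  fixes \<theta> :: real
  assumes "real M * \<theta> \<in> \<int>"
  shows "(\<Sum>l<M. cis (2 * pi * (real l * \<theta>))) = (if \<theta> \<in> \<int> then of_nat M else 0)"
proof -
  have pow: "cis (2 * pi * (real l * \<theta>)) = cis (2 * pi * \<theta>) ^ l" for l
    by (simp add: DeMoivre algebra_simps)
  show ?thesis
  proof (cases "\<theta> \<in> \<int>")
    case True
    then show ?thesis by (simp add: pow)
  next
    case False
    have "cis (2 * pi * \<theta>) \<noteq> 1"
    proof
      assume "cis (2 * pi * \<theta>) = 1"
      then have "cos (2 * pi * \<theta>) = 1" by (metis cis.sel(1) one_complex.sel(1))
      then obtain m :: int where "2 * pi * \<theta> = of_int m * 2 * pi"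
        by (auto simp: cos_one_2pi_int)
      then have "\<theta> = of_int m" by simp
      with False show False by simp
    qed
    moreover have "cis (2 * pi * \<theta>) ^ M = 1"
      using assms by (simp flip: pow)
    ultimately show ?thesis
      using False by (simp add: pow geometric_sum)
  qed
qed

lemma sum_multiples_below:
  fixes g :: "nat \<Rightarrow> 'a::comm_monoid_add"
  assumes "n > 0" "n dvd M"
  shows "(\<Sum>l | l < M \<and> n dvd l. g l) = (\<Sum>m<M div n. g (n * m))"
proof (rule sum.reindex_bij_witness[where i = "\<lambda>m. n * m" and j = "\<lambda>l. l div n"])
qed (use assms in \<open>auto simp: div_less_iff_less_mult elim!: dvdE\<close>)

text \<open>Removing the multiples of \<open>n\<close> removes a complete sum of length
  \<open>M div n\<close> at frequency \<open>n * \<theta>\<close>. Both terms vanish once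
  \<open>n * \<theta>\<close> is not an integer, which is why the resonance condition carries the
  factor \<open>n\<close>.\<close>

lemma sum_cis_nonmultiples:
  fixes \<theta> :: real
  assumes "real M * \<theta> \<in> \<int>" "n > 0" "n dvd M"
  shows "(\<Sum>l | l < M \<and> \<not> n dvd l. cis (2 * pi * (real l * \<theta>))) =
    (if \<theta> \<in> \<int> then of_nat M else 0) - (if real n * \<theta> \<in> \<int> then of_nat (M div n) else 0)"
proof -
  let ?g = "\<lambda>l. cis (2 * pi * (real l * \<theta>))"
  have "(\<Sum>l<M. ?g l) = (\<Sum>l | l < M \<and> n dvd l. ?g l) + (\<Sum>l | l < M \<and> \<not> n dvd l. ?g l)"
    by (subst sum.union_disjoint[symmetric]) (auto intro!: sum.cong)
  moreover have "(\<Sum>l | l < M \<and> n dvd l. ?g l) = (\<Sum>m<M div n. cis (2 * pi * (real m * (real n * \<theta>))))"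
    using assms by (simp add: sum_multiples_below algebra_simps)
  moreover have "real (M div n) * (real n * \<theta>) \<in> \<int>"
    using assms by (auto elim!: dvdE simp: mult_ac)
  ultimately show ?thesis
    using sum_cis_multiples[OF assms(1)] sum_cis_multiples[of "M div n" "real n * \<theta>"] by simp
qed

lemma card_nonmultiples_below:
  fixes n M :: nat
  assumes "n > 0" "n dvd M"
  shows "real (card {l. l < M \<and> \<not> n dvd l}) = real M - real M / real n"
proof -
  \<comment> \<open>The cardinality is the sum at frequency 0.\<close>
  have "complex_of_real (real (card {l. l < M \<and> \<not> n dvd l})) = of_real (real M - real M / real n)"
    using sum_cis_nonmultiples[of M 0 n] assms by (auto elim!: dvdE)
  then show ?thesis using of_real_eq_iff by blast
qed

section \<open>Bernstein polynomials in the squared cosine as trigonometric polynomials\<close>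

text \<open>The argument \<open>c\<close> is the constant Fourier coefficient.\<close>

definition trig_poly :: "nat \<Rightarrow> complex \<Rightarrow> (real \<Rightarrow> real) \<Rightarrow> bool" where
  "trig_poly D c f \<longleftrightarrow> (\<exists>a::int \<Rightarrow> complex. a 0 = c \<and>
     (\<forall>x. complex_of_real (f x) = (\<Sum>r=-int D..int D. a r * cis (2 * pi * (of_int r * x)))))"

lemma trig_poly_sum:
  assumes "\<And>i. i \<in> I \<Longrightarrow> trig_poly D (c i) (f i)"
  shows "trig_poly D (\<Sum>i\<in>I. c i) (\<lambda>x. \<Sum>i\<in>I. f i x)"
proof -
  have "\<forall>i\<in>I. \<exists>a::int \<Rightarrow> complex. a 0 = c i \<and>
     (\<forall>x. complex_of_real (f i x) = (\<Sum>r=-int D..int D. a r * cis (2 * pi * (of_int r * x))))"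
    using assms by (simp add: trig_poly_def)
  then obtain a :: "_ \<Rightarrow> int \<Rightarrow> complex" where a: "\<And>i. i \<in> I \<Longrightarrow> a i 0 = c i"
    "\<And>i x. i \<in> I \<Longrightarrow> complex_of_real (f i x) = (\<Sum>r=-int D..int D. a i r * cis (2 * pi * (of_int r * x)))"
    by (auto dest!: bchoice)
  show ?thesis unfolding trig_poly_def
  proof (intro exI[of _ "\<lambda>r. \<Sum>i\<in>I. a i r"] conjI allI)
    fix x
    show "complex_of_real (\<Sum>i\<in>I. f i x) =
       (\<Sum>r=-int D..int D. (\<Sum>i\<in>I. a i r) * cis (2 * pi * (of_int r * x)))"
      by (simp add: a sum_distrib_right) (rule sum.swap)
  qed (simp add: a)
qed

text \<open>Multiplying by the \<open>D\<close>-th power of z = e(x) shifts the frequencies -D..D to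
  the exponents 0..2D, so a polynomial identity on the unit circle suffices. Frequency 0 lands at
  exponent \<open>D\<close>.\<close>

lemma trig_poly_Laurent:
  fixes p :: "complex poly"
  assumes "degree p \<le> 2 * D"
    and "\<And>x. complex_of_real (f x) * cis (2 * pi * x) ^ D = poly p (cis (2 * pi * x))"
  shows "trig_poly D (coeff p D) f"
  unfolding trig_poly_def
proof (intro exI[of _ "\<lambda>r. coeff p (nat (r + int D))"] conjI allI)
  fix x :: real
  let ?z = "cis (2 * pi * x)"
  have z: "?z ^ D \<noteq> 0" by simp
  have "poly p ?z = (\<Sum>i\<le>2*D. coeff p i * ?z ^ i)"
    unfolding poly_altdef using assms(1) by (intro sum.mono_neutral_left) (auto simp: coeff_eq_0)
  also have "\<dots> = (\<Sum>r=-int D..int D. coeff p (nat (r + int D)) * ?z ^ nat (r + int D))"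
    by (rule sum.reindex_bij_witness[where i = "\<lambda>r. nat (r + int D)" and j = "\<lambda>i. int i - int D"]) auto
  also have "\<dots> = (\<Sum>r=-int D..int D. coeff p (nat (r + int D)) * cis (2 * pi * (of_int r * x))) * ?z ^ D"
    unfolding sum_distrib_right
    by (intro sum.cong refl) (auto simp: DeMoivre cis_mult algebra_simps)
  finally show "complex_of_real (f x) =
      (\<Sum>r=-int D..int D. coeff p (nat (r + int D)) * cis (2 * pi * (of_int r * x)))"
    using assms(2)[of x] z by simp
qed simp

text \<open>With \<open>z = e(x)\<close> one has \<open>cos\<^sup>2(\<pi>x) = (1+z)\<^sup>2/(4z)\<close> and \<open>sin\<^sup>2(\<pi>x) = -(1-z)\<^sup>2/(4z)\<close>.\<close>

lemma trig_poly_Bernstein: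
  assumes "i \<le> D"
  shows "\<exists>c. trig_poly D c (\<lambda>x. Bernstein D i ((cos (pi * x))\<^sup>2))"
proof -
  define p :: "complex poly" where
    "p = smult (of_nat (D choose i)) ([:1/4, 2/4, 1/4:] ^ i * [:-1/4, 2/4, -1/4:] ^ (D - i))"
  have "degree p \<le> degree ([:1/4, 2/4, 1/4:] ^ i * [:-1/4, 2/4, -1/4:] ^ (D - i) :: complex poly)"
    unfolding p_def by (rule degree_smult_le)
  also have "\<dots> \<le> degree ([:1/4, 2/4, 1/4:] ^ i :: complex poly) + degree ([:-1/4, 2/4, -1/4:] ^ (D - i) :: complex poly)"
    by (rule degree_mult_le)
  also have "\<dots> \<le> 2 * i + 2 * (D - i)"
    by (rule add_mono; rule order_trans[OF degree_power_le]) simp_all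
  finally have deg: "degree p \<le> 2 * D" using assms by simp
  have "complex_of_real (Bernstein D i ((cos (pi * x))\<^sup>2)) * cis (2 * pi * x) ^ D = poly p (cis (2 * pi * x))" for x
  proof -
    \<comment> \<open>The half-angle point \<open>?w\<close>, a square root of \<open>?z\<close>,
      makes \<open>cos (pi * x)\<close> rational in a single variable.\<close>
    let ?z = "cis (2 * pi * x)" and ?w = "cis (pi * x)"
    have zw: "?z = ?w ^ 2" by (simp add: DeMoivre mult_ac)
    have c: "complex_of_real (cos (pi * x)) = (?w + inverse ?w) / 2"
      by (simp add: complex_eq_iff)
    have w0: "?w \<noteq> 0" by simp
    have 1: "complex_of_real ((cos (pi * x))\<^sup>2) * ?z = poly [:1/4, 2/4, 1/4:] ?z"
      unfolding of_real_power c zw using w0 by (simp add: field_simps power2_eq_square del: cis_inverse)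
    have 2: "complex_of_real (1 - (cos (pi * x))\<^sup>2) * ?z = poly [:-1/4, 2/4, -1/4:] ?z"
      using 1 by (simp add: algebra_simps)
    \<comment> \<open>Each of the \<open>i\<close> cosine factors and each of the
      \<open>D - i\<close> sine factors absorbs one power of \<open>?z\<close>.\<close>
    have "?z ^ D = ?z ^ i * ?z ^ (D - i)" using assms by (simp flip: power_add)
    then have "complex_of_real (Bernstein D i ((cos (pi * x))\<^sup>2)) * ?z ^ D =
       of_nat (D choose i) * ((complex_of_real ((cos (pi * x))\<^sup>2) * ?z) ^ i *
         (complex_of_real (1 - (cos (pi * x))\<^sup>2) * ?z) ^ (D - i))"
      by (simp add: Bernstein_def power_mult_distrib mult_ac)
    also have "\<dots> = poly p ?z" unfolding 1 2 p_def by simp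
    finally show ?thesis .
  qed
  with deg show ?thesis by (intro exI[of _ "coeff p D"] trig_poly_Laurent)
qed


section \<open>Exact averages of trigonometric polynomials\<close>

lemma cis_sum: "cis (\<Sum>j\<in>J. g j) = (\<Prod>j\<in>J. cis (g j))"
  by (induction J rule: infinite_finite_induct) (simp_all flip: cis_mult)

text \<open>Expanding the product gives one exponential sum per frequency vector in a box, and
  non-resonance kills all but the zero vector. The subset \<open>I\<close> of \<open>J\<close>
  allows products with an index left out under the same non-resonance hypothesis.\<close>

lemma sum_prod_trig_poly:
  fixes u :: "'a \<Rightarrow> real" and f :: "real \<Rightarrow> real"
  assumes "finite J" "I \<subseteq> J" and tp: "trig_poly D c f"
    and Mu: "\<And>j. j \<in> J \<Longrightarrow> real M * u j \<in> \<int>"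
    and n: "n > 0" "n dvd M"
    and nonres: "\<And>r::'a \<Rightarrow> int. \<forall>j\<in>J. \<bar>r j\<bar> \<le> int D \<Longrightarrow> \<exists>j\<in>J. r j \<noteq> 0 \<Longrightarrow>
      real n * (\<Sum>j\<in>J. of_int (r j) * u j) \<notin> \<int>"
  shows "complex_of_real (\<Sum>l | l < M \<and> \<not> n dvd l. \<Prod>j\<in>I. f (real l * u j)) =
    of_real (real M - real M / real n) * c ^ card I"
proof -
  obtain a :: "int \<Rightarrow> complex" where a0: "a 0 = c"
    and a: "\<And>x. complex_of_real (f x) = (\<Sum>r=-int D..int D. a r * cis (2 * pi * (of_int r * x)))"
    using tp unfolding trig_poly_def by blast
  have fI: "finite I" using assms(1,2) by (rule finite_subset[rotated])
  define R where "R = (\<Pi>\<^sub>E j\<in>I. {-int D..int D})"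
  define A where "A r = (\<Prod>j\<in>I. a (r j))" for r :: "'a \<Rightarrow> int"
  define \<theta> where "\<theta> r = (\<Sum>j\<in>I. of_int (r j) * u j)" for r :: "'a \<Rightarrow> int"
  \<comment> \<open>Restricted to \<open>I\<close>, because members of the \<open>PiE\<close> set
    \<open>R\<close> are \<open>undefined\<close> outside \<open>I\<close>.\<close>
  define zero where "zero = (\<lambda>j\<in>I. 0::int)"
  have finR: "finite R" unfolding R_def using fI by (intro finite_PiE) auto
  have zero: "zero \<in> R" unfolding R_def zero_def by auto
  have expand: "complex_of_real (\<Prod>j\<in>I. f (real l * u j)) = (\<Sum>r\<in>R. A r * cis (2 * pi * (real l * \<theta> r)))" for l
  proof -
    have "complex_of_real (\<Prod>j\<in>I. f (real l * u j)) =
       (\<Sum>r\<in>R. \<Prod>j\<in>I. a (r j) * cis (2 * pi * (of_int (r j) * (real l * u j))))"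
      unfolding of_real_prod a R_def using fI by (intro prod_sum_PiE) auto
    also have "\<dots> = (\<Sum>r\<in>R. A r * cis (2 * pi * (real l * \<theta> r)))"
      by (simp add: A_def \<theta>_def prod.distrib sum_distrib_left mult_ac flip: cis_sum)
    finally show ?thesis .
  qed
  have inner: "(\<Sum>l | l < M \<and> \<not> n dvd l. cis (2 * pi * (real l * \<theta> r))) =
      (if r = zero then of_real (real M - real M / real n) else 0)" if r: "r \<in> R" for r
  proof -
    have "real M * \<theta> r = (\<Sum>j\<in>I. of_int (r j) * (real M * u j))"
      by (simp add: \<theta>_def sum_distrib_left mult_ac)
    also have "\<dots> \<in> \<int>" using Mu \<open>I \<subseteq> J\<close> by (intro Ints_sum Ints_mult[OF Ints_of_int]) auto
    finally have eq: "(\<Sum>l | l < M \<and> \<not> n dvd l. cis (2 * pi * (real l * \<theta> r))) =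
       (if \<theta> r \<in> \<int> then of_nat M else 0) - (if real n * \<theta> r \<in> \<int> then of_nat (M div n) else 0)"
      by (rule sum_cis_nonmultiples[OF _ n])
    show ?thesis
    proof (cases "r = zero")
      case True
      then have "\<theta> r = 0" by (simp add: \<theta>_def zero_def)
      then show ?thesis unfolding eq using True n by (auto elim!: dvdE)
    next
      case False
      \<comment> \<open>Extension by 0 to \<open>J\<close>: \<open>nonres\<close> concerns vectors
        on \<open>J\<close>, where \<open>r\<close> itself may take the value
        \<open>undefined\<close>.\<close>
      define r' where "r' j = (if j \<in> I then r j else 0)" for j
      have "\<exists>j\<in>I. r j \<noteq> 0"
      proof (rule ccontr)
        assume "\<not> ?thesis"
        then have "r = zero" using r unfolding R_def zero_def
          by (intro PiE_ext[where k = I and s = "\<lambda>_. {-int D..int D}"]) auto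
        with False show False by simp
      qed
      then have "\<exists>j\<in>J. r' j \<noteq> 0" using \<open>I \<subseteq> J\<close> by (auto simp: r'_def)
      moreover have "\<forall>j\<in>J. \<bar>r' j\<bar> \<le> int D" using r by (auto simp: R_def r'_def PiE_iff abs_le_iff)
      ultimately have "real n * (\<Sum>j\<in>J. of_int (r' j) * u j) \<notin> \<int>" by (intro nonres)
      also have "(\<Sum>j\<in>J. of_int (r' j) * u j) = \<theta> r"
        unfolding \<theta>_def using assms(1,2) by (intro sum.mono_neutral_cong_right) (auto simp: r'_def)
      finally have "real n * \<theta> r \<notin> \<int>" .
      moreover from this have "\<theta> r \<notin> \<int>" by (auto intro: Ints_mult)
      ultimately show ?thesis unfolding eq using False by simp
    qed
  qed
  have "complex_of_real (\<Sum>l | l < M \<and> \<not> n dvd l. \<Prod>j\<in>I. f (real l * u j)) =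
      (\<Sum>r\<in>R. A r * (\<Sum>l | l < M \<and> \<not> n dvd l. cis (2 * pi * (real l * \<theta> r))))"
    unfolding of_real_sum expand sum_distrib_left by (rule sum.swap)
  also have "\<dots> = (\<Sum>r\<in>R. if r = zero then A r * of_real (real M - real M / real n) else 0)"
    by (intro sum.cong refl) (simp add: inner)
  also have "\<dots> = A zero * of_real (real M - real M / real n)"
    using finR zero by (simp add: sum.delta')
  also have "A zero = c ^ card I" by (simp add: A_def zero_def a0)
  finally show ?thesis by (simp add: mult_ac)
qed

text \<open>Sampling at \<open>q\<close> equally spaced points is exact, since 0 is the only
  frequency of size at most \<open>D < q\<close> divisible by \<open>q\<close>. This replaces an
  integral and shows that \<open>c\<close> is real.\<close>

lemma trig_poly_mean:
  assumes "trig_poly D c f" "D < q"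
  shows "c = of_real ((\<Sum>a<q. f (real a / real q)) / real q)"
proof -
  obtain b :: "int \<Rightarrow> complex" where b0: "b 0 = c"
    and b: "\<And>x. complex_of_real (f x) = (\<Sum>r=-int D..int D. b r * cis (2 * pi * (of_int r * x)))"
    using assms(1) unfolding trig_poly_def by blast
  have inner: "(\<Sum>a<q. cis (2 * pi * (of_int r * (real a / real q)))) = (if r = 0 then of_nat q else 0)"
    if "r \<in> {-int D..int D}" for r
  proof -
    have "(of_int r / real q \<in> \<int>) \<longleftrightarrow> r = 0"
    proof
      assume "of_int r / real q \<in> \<int>"
      then obtain m :: int where "of_int r / real q = of_int m" by (auto elim: Ints_cases)
      then have "real_of_int r = of_int (m * int q)" using assms(2) by (simp add: field_simps)
      then have "r = m * int q" by (simp only: of_int_eq_iff)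
      then have "int q dvd r" by simp
      moreover have "\<bar>r\<bar> < int q" using that assms(2) by auto
      ultimately show "r = 0" using dvd_imp_le_int[of r "int q"] by linarith
    qed simp
    moreover have "(\<Sum>a<q. cis (2 * pi * (of_int r * (real a / real q)))) =
        (\<Sum>a<q. cis (2 * pi * (real a * (of_int r / real q))))" by (simp add: mult_ac)
    ultimately show ?thesis using sum_cis_multiples[of q "of_int r / real q"] assms(2) by simp
  qed
  have "complex_of_real (\<Sum>a<q. f (real a / real q)) =
      (\<Sum>r=-int D..int D. b r * (\<Sum>a<q. cis (2 * pi * (of_int r * (real a / real q)))))"
    unfolding of_real_sum b sum_distrib_left by (rule sum.swap)
  also have "\<dots> = (\<Sum>r=-int D..int D. if r = 0 then b r * of_nat q else 0)"
    by (intro sum.cong refl) (simp add: inner del: times_divide_eq_right)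
  also have "\<dots> = c * of_nat q" by (simp add: sum.delta' b0)
  finally show ?thesis using assms(2) by (simp add: field_simps)
qed

section \<open>A trigonometric cutoff from binomial concentration\<close>

text \<open>Chebyshev's inequality for a binomial variable with mean \<open>D * t\<close> and
  variance \<open>D * t * (1 - t)\<close>, the latter at most \<open>D / 4\<close>.\<close>

lemma Bernstein_Chebyshev:
  assumes t: "0 \<le> t" "t \<le> 1" and "D > 0" "g > 0"
    and S: "\<And>i. i \<in> S \<Longrightarrow> i \<le> D \<and> real D * g \<le> \<bar>real i - real D * t\<bar>"
  shows "(\<Sum>i\<in>S. Bernstein D i t) \<le> 1 / (4 * g\<^sup>2) / real D"
proof -
  have SD: "S \<subseteq> {..D}" using S by auto
  have "(real D * g)\<^sup>2 * (\<Sum>i\<in>S. Bernstein D i t) \<le> (\<Sum>i\<in>S. (real i - real D * t)\<^sup>2 * Bernstein D i t)"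
    unfolding sum_distrib_left
  proof (intro sum_mono mult_right_mono)
    fix i assume "i \<in> S"
    then have "(real D * g)\<^sup>2 \<le> \<bar>real i - real D * t\<bar>\<^sup>2"
      using S assms by (intro power_mono) auto
    then show "(real D * g)\<^sup>2 \<le> (real i - real D * t)\<^sup>2" by simp
  qed (use t Bernstein_nonneg in auto)
  also have "\<dots> \<le> (\<Sum>i\<le>D. (real i - real D * t)\<^sup>2 * Bernstein D i t)"
    using SD t by (intro sum_mono2) (auto intro!: mult_nonneg_nonneg Bernstein_nonneg)
  \<comment> \<open>The square is rewritten through \<open>i * (i - 1)\<close>, \<open>i\<close> and
    1, whose Bernstein sums are the known factorial moments.\<close>
  also have "\<dots> = (\<Sum>i\<le>D. real i * (real i - 1) * Bernstein D i t +
      ((1 - 2 * real D * t) * (real i * Bernstein D i t) + (real D * t)\<^sup>2 * Bernstein D i t))"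
    by (intro sum.cong refl) (simp add: algebra_simps power2_eq_square)
  also have "\<dots> = real D * (t * (1 - t))"
    by (simp add: sum.distrib flip: sum_distrib_left) (simp add: algebra_simps power2_eq_square)
  also have "\<dots> \<le> real D * (1 / 4)"
  proof (rule mult_left_mono)
    have "0 \<le> (t - 1/2)\<^sup>2" by simp
    then show "t * (1 - t) \<le> 1 / 4" by (simp add: power2_eq_square algebra_simps)
  qed simp
  finally show ?thesis using assms by (simp add: field_simps power2_eq_square)
qed

lemma cos_sq_dist_nearest_int: "(cos (pi * x))\<^sup>2 = (cos (pi * dist_nearest_int x))\<^sup>2"
proof -
  define y where "y = x - of_int (round x)"
  have "(cos (pi * dist_nearest_int x))\<^sup>2 = (cos (pi * y))\<^sup>2"
    by (simp add: dist_nearest_int_def y_def[symmetric] abs_if)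
  moreover have "cos (pi * x) = cos (pi * y + pi * of_int (round x))"
    by (simp add: y_def algebra_simps)
  \<comment> \<open>An integer multiple of pi changes only the sign, which the square
    removes.\<close>
  ultimately show ?thesis by (simp add: cos_add)
qed

lemma dist_nearest_int_bounds: "0 \<le> dist_nearest_int x" "dist_nearest_int x \<le> 1 / 2"
  using of_int_round_abs_le[of x] by (auto simp: dist_nearest_int_def abs_minus_commute)

text \<open>\<open>K\<close> depends only on \<alpha> and \<beta>, so the errors tend to 0 as
  \<open>D\<close> grows. The mean is bounded through [0, \<alpha>] alone, as \<open>F\<close> is
  nonnegative elsewhere.\<close>

lemma exists_trig_cutoff:
  assumes "0 < \<alpha>" "\<alpha> < \<beta>" "\<beta> < 1 / 2"
  shows "\<exists>K>0. \<forall>D>0. \<exists>F c. trig_poly D (of_real c) F \<and> (\<forall>x. 0 \<le> F x \<and> F x \<le> 1) \<and>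
    (\<forall>x. dist_nearest_int x > \<beta> \<longrightarrow> F x \<le> K / real D) \<and> \<alpha> * (1 - K / real D) \<le> c"
proof -
  define s where "s = (\<lambda>x. (cos (pi * x))\<^sup>2)"
  have s01: "0 \<le> s x" "s x \<le> 1" for x by (auto simp: s_def abs_square_le_1)
  have s_mono: "s y \<le> s x" if "0 \<le> x" "x \<le> y" "y \<le> 1/2" for x y
  proof -
    have "0 \<le> pi * y" "pi * y \<le> pi / 2" using that by auto
    moreover from this have "- (pi / 2) \<le> pi * y" using pi_ge_zero by linarith
    ultimately show ?thesis unfolding s_def using that
      by (intro power_mono cos_monotone_0_pi_le cos_ge_zero) auto
  qed
  have "cos (pi * \<beta>) < cos (pi * \<alpha>)" using assms by (intro cos_monotone_0_pi) auto
  moreover have "0 \<le> cos (pi * \<beta>)"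
  proof (rule cos_ge_zero)
    have "0 \<le> pi * \<beta>" using assms by simp
    then show "- (pi / 2) \<le> pi * \<beta>" using pi_ge_zero by linarith
  qed (use assms in simp)
  ultimately have "s \<beta> < s \<alpha>" unfolding s_def by (intro power_strict_mono) auto
  \<comment> \<open>The threshold \<open>t0\<close> is the midpoint of \<open>s \<beta>\<close> and
    \<open>s \<alpha>\<close>, leaving the margin \<open>g\<close> on both sides; \<open>K\<close>
    is the Chebyshev constant for that margin.\<close>
  define g where "g = (s \<alpha> - s \<beta>) / 2"
  define t0 where "t0 = (s \<alpha> + s \<beta>) / 2"
  define K where "K = 1 / (4 * g\<^sup>2)"
  have g: "g > 0" using \<open>s \<beta> < s \<alpha>\<close> by (simp add: g_def)
  have t0: "t0 = s \<beta> + g" "t0 = s \<alpha> - g" by (simp_all add: t0_def g_def field_simps)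
  have "\<exists>F c. trig_poly D (of_real c) F \<and> (\<forall>x. 0 \<le> F x \<and> F x \<le> 1) \<and>
    (\<forall>x. dist_nearest_int x > \<beta> \<longrightarrow> F x \<le> K / real D) \<and> \<alpha> * (1 - K / real D) \<le> c"
    if D: "D > 0" for D :: nat
  proof -
    define S where "S = {i. i \<le> D \<and> real D * t0 \<le> real i}"
    define F where "F = (\<lambda>x. \<Sum>i\<in>S. Bernstein D i (s x))"
    have SD: "S \<subseteq> {..D}" by (auto simp: S_def)
    have "\<forall>i\<in>S. \<exists>c. trig_poly D c (\<lambda>x. Bernstein D i (s x))"
      unfolding s_def using SD trig_poly_Bernstein by auto
    then obtain c where "\<And>i. i \<in> S \<Longrightarrow> trig_poly D (c i) (\<lambda>x. Bernstein D i (s x))"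
      by (auto dest!: bchoice)
    then have tp: "trig_poly D (\<Sum>i\<in>S. c i) F" unfolding F_def by (rule trig_poly_sum)
    \<comment> \<open>\<open>Suc D\<close> is the least number of sample points for which the
      discrete mean is exact.\<close>
    define d where "d = (\<Sum>a<Suc D. F (real a / real (Suc D))) / real (Suc D)"
    have cd: "(\<Sum>i\<in>S. c i) = of_real d"
      unfolding d_def by (rule trig_poly_mean[OF tp]) simp
    have split: "F x + (\<Sum>i\<in>{..D} - S. Bernstein D i (s x)) = 1" for x
      using sum.subset_diff[OF SD, of "\<lambda>i. Bernstein D i (s x)"] by (simp add: F_def add.commute)
    have F0: "0 \<le> F x" for x unfolding F_def by (intro sum_nonneg Bernstein_nonneg s01)
    have F1: "F x \<le> 1" for x
    proof -
      have "0 \<le> (\<Sum>i\<in>{..D} - S. Bernstein D i (s x))" by (intro sum_nonneg Bernstein_nonneg s01)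
      with split[of x] show ?thesis by linarith
    qed
    have far: "F x \<le> K / real D" if x: "dist_nearest_int x > \<beta>" for x
      unfolding F_def K_def
    proof (rule Bernstein_Chebyshev[OF s01 D g])
      fix i assume i: "i \<in> S"
      have "s x = s (dist_nearest_int x)" unfolding s_def by (rule cos_sq_dist_nearest_int)
      also have "\<dots> \<le> s \<beta>" using x assms dist_nearest_int_bounds[of x] by (intro s_mono) auto
      finally have "real D * (s x + g) \<le> real D * t0" unfolding t0 by (intro mult_left_mono) auto
      with i show "i \<le> D \<and> real D * g \<le> \<bar>real i - real D * s x\<bar>" by (auto simp: S_def algebra_simps)
    qed
    have near: "1 - K / real D \<le> F x" if x: "0 \<le> x" "x \<le> \<alpha>" for x
    proof -
      have "(\<Sum>i\<in>{..D} - S. Bernstein D i (s x)) \<le> K / real D"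
        unfolding K_def
      proof (rule Bernstein_Chebyshev[OF s01 D g])
        fix i assume i: "i \<in> {..D} - S"
        have "s \<alpha> \<le> s x" using x assms by (intro s_mono) auto
        then have "real D * t0 \<le> real D * (s x - g)" unfolding t0(2) by (intro mult_left_mono) auto
        with i show "i \<le> D \<and> real D * g \<le> \<bar>real i - real D * s x\<bar>" by (auto simp: S_def algebra_simps)
      qed
      with split[of x] show ?thesis by linarith
    qed
    have "\<alpha> * (1 - K / real D) \<le> d"
    \<comment> \<open>The sign matters when multiplying by this factor; if it is negative,
      \<open>0 \<le> d\<close> is enough.\<close>
    proof (cases "1 - K / real D \<ge> 0")
      case True
      define q where "q = Suc D"
      \<comment> \<open>The points 0, ..., m all satisfy \<open>a / q \<le> \<alpha>\<close>.
        Counting 0, there are \<open>m + 1 > \<alpha> * q\<close> of them, so rounding costs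
        nothing.\<close>
      define m where "m = nat \<lfloor>\<alpha> * real q\<rfloor>"
      have m: "real m \<le> \<alpha> * real q" "\<alpha> * real q < real m + 1"
        using assms by (auto simp: m_def q_def)
      have "\<alpha> * real q < 1 * real q" using assms by (intro mult_strict_right_mono) (auto simp: q_def)
      then have mq: "m < q" using m by linarith
      have "\<alpha> * real q * (1 - K / real D) \<le> (real m + 1) * (1 - K / real D)"
        using m True by (intro mult_right_mono) auto
      also have "\<dots> = (\<Sum>a\<le>m. 1 - K / real D)" by simp
      also have "\<dots> \<le> (\<Sum>a\<le>m. F (real a / real q))"
      proof (intro sum_mono near)
        fix a assume "a \<in> {..m}"
        then have "real a \<le> \<alpha> * real q" using m by auto
        then show "real a / real q \<le> \<alpha>" by (simp add: q_def field_simps)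
      qed simp
      also have "\<dots> \<le> (\<Sum>a<q. F (real a / real q))"
        using mq F0 by (intro sum_mono2) auto
      also have "\<dots> = d * real q" by (simp add: d_def q_def)
      finally have "(\<alpha> * (1 - K / real D)) * real q \<le> d * real q" by (simp add: mult_ac)
      then show ?thesis by (simp add: q_def mult_le_cancel_right)
    next
      case False
      then have "\<alpha> * (1 - K / real D) \<le> 0" using assms by (simp add: mult_le_0_iff)
      also have "0 \<le> d" unfolding d_def using F0 by (intro divide_nonneg_nonneg sum_nonneg) auto
      finally show ?thesis .
    qed
    with tp cd F0 F1 far show ?thesis by metis
  qed
  moreover have "K > 0" using g by (simp add: K_def)
  ultimately show ?thesis by blast
qed

section \<open>Counting under non-resonance\<close>

lemma prod_le_factor_times_prod:
  fixes f :: "'a \<Rightarrow> real"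
  assumes "finite J" "j \<in> J" "f j \<le> \<epsilon>" "\<And>i. i \<in> J \<Longrightarrow> 0 \<le> f i"
  shows "prod f J \<le> \<epsilon> * prod f (J - {j})"
  using assms by (subst prod.remove[of J j]) (auto intro!: mult_right_mono prod_nonneg)

text \<open>Weights are at most 1, so the count is at least the total weight minus the weight
  outside the set. Averaging the other \<open>k - 1\<close> factors exactly keeps the loss
  proportional to \<open>c ^ (k - 1)\<close>, comparable with the exponentially small main term
  \<open>c ^ k\<close>.\<close>

lemma card_C_minus_ge:
  assumes tp: "trig_poly D (of_real c) F" and F: "\<And>x. 0 \<le> F x" "\<And>x. F x \<le> 1"
    and far: "\<And>x. dist_nearest_int x > \<eta> \<Longrightarrow> F x \<le> \<epsilon>" and "0 \<le> \<epsilon>"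
    and Mu: "\<And>j. j \<in> {1..k} \<Longrightarrow> real M * u j \<in> \<int>"
    and n: "n > 0" "n dvd M"
    and nonres: "\<And>r::nat \<Rightarrow> int. \<forall>j\<in>{1..k}. \<bar>r j\<bar> \<le> int D \<Longrightarrow> \<exists>j\<in>{1..k}. r j \<noteq> 0 \<Longrightarrow>
      real n * (\<Sum>j=1..k. of_int (r j) * u j) \<notin> \<int>"
  shows "(real M - real M / real n) * (c ^ k - real k * \<epsilon> * c ^ (k - 1)) \<le> real (card (C_minus M u n \<eta> k))"
proof -
  define L where "L = {l. l < M \<and> \<not> n dvd l}"
  define W where "W I l = (\<Prod>j\<in>I. F (real l * u j))" for I l
  let ?J = "{1..k}" and ?C = "C_minus M u n \<eta> k"
  have C: "?C = {l\<in>L. \<forall>j\<in>?J. dist_nearest_int (real l * u j) \<le> \<eta>}"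
    by (auto simp: C_minus_def L_def cong_0_iff)
  have finL: "finite L" by (simp add: L_def)
  have W0: "0 \<le> W I l" for I l unfolding W_def by (intro prod_nonneg) (simp add: F)
  have mean: "(\<Sum>l\<in>L. W I l) = (real M - real M / real n) * c ^ card I" if "I \<subseteq> ?J" for I
  proof -
    have "complex_of_real (\<Sum>l\<in>L. W I l) = of_real (real M - real M / real n) * of_real c ^ card I"
      unfolding L_def W_def by (rule sum_prod_trig_poly[OF _ that tp Mu n nonres]) auto
    then show ?thesis unfolding of_real_power[symmetric] of_real_mult[symmetric] of_real_eq_iff .
  qed
  \<comment> \<open>Union bound: summing over all \<open>j\<close> covers whichever index violates
    the constraint.\<close>
  have "(\<Sum>l\<in>L - ?C. W ?J l) \<le> (\<Sum>l\<in>L - ?C. \<Sum>j\<in>?J. \<epsilon> * W (?J - {j}) l)"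
  proof (rule sum_mono)
    fix l assume "l \<in> L - ?C"
    then obtain j where j: "j \<in> ?J" "dist_nearest_int (real l * u j) > \<eta>" by (auto simp: C not_le)
    have "W ?J l \<le> \<epsilon> * W (?J - {j}) l"
      unfolding W_def using j F far by (intro prod_le_factor_times_prod) auto
    also have "\<dots> \<le> (\<Sum>j\<in>?J. \<epsilon> * W (?J - {j}) l)"
      using j W0 \<open>0 \<le> \<epsilon>\<close> by (intro member_le_sum) auto
    finally show "W ?J l \<le> (\<Sum>j\<in>?J. \<epsilon> * W (?J - {j}) l)" .
  qed
  \<comment> \<open>Enlarging the range to all of \<open>L\<close> makes the exact mean
    applicable.\<close>
  also have "\<dots> \<le> (\<Sum>l\<in>L. \<Sum>j\<in>?J. \<epsilon> * W (?J - {j}) l)"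
    using finL W0 \<open>0 \<le> \<epsilon>\<close> by (intro sum_mono2 sum_nonneg mult_nonneg_nonneg) auto
  also have "\<dots> = (\<Sum>j\<in>?J. \<epsilon> * (\<Sum>l\<in>L. W (?J - {j}) l))"
    unfolding sum_distrib_left by (rule sum.swap)
  also have "\<dots> = (\<Sum>j\<in>?J. \<epsilon> * ((real M - real M / real n) * c ^ (k - 1)))"
    by (intro sum.cong refl) (simp add: mean)
  finally have out: "(\<Sum>l\<in>L - ?C. W ?J l) \<le> real k * \<epsilon> * ((real M - real M / real n) * c ^ (k - 1))"
    by simp
  have "(\<Sum>l\<in>?C. W ?J l) \<le> (\<Sum>l\<in>?C. 1)"
    unfolding W_def by (intro sum_mono prod_le_1) (simp add: F)
  moreover have "(\<Sum>l\<in>L. W ?J l) = (\<Sum>l\<in>L - ?C. W ?J l) + (\<Sum>l\<in>?C. W ?J l)"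
    using finL by (intro sum.subset_diff) (auto simp: C)
  moreover have "(\<Sum>l\<in>L. W ?J l) = (real M - real M / real n) * c ^ k"
    by (simp add: mean)
  ultimately show ?thesis using out by (simp add: algebra_simps)
qed

lemma card_C_minus_ge_of_nonresonant:
  assumes N: "N > 4"
  shows "\<exists>k\<^sub>0::nat. \<forall>k\<ge>k\<^sub>0. \<forall>(M::nat) (n::nat) (u::nat \<Rightarrow> real).
    (\<forall>j\<in>{1..k}. real M * u j \<in> \<int>) \<and> n \<ge> 2 \<and> n dvd M \<and>
    (\<forall>r::nat \<Rightarrow> int. (\<forall>j\<in>{1..k}. \<bar>r j\<bar> \<le> int (k\<^sup>2)) \<longrightarrow> (\<exists>j\<in>{1..k}. r j \<noteq> 0) \<longrightarrow>
      real n * (\<Sum>j=1..k. of_int (r j) * u j) \<notin> \<int>) \<longrightarrow>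
    real M / (real n * N ^ k) \<le> real (card (C_minus M u n (2 / N) k))"
proof -
  \<comment> \<open>The cutoff needs \<open>2 / N < 1 / 2\<close>, which is exactly
    \<open>N > 4\<close>.\<close>
  obtain K where K: "K > 0" and cutoff: "\<And>D. D > 0 \<Longrightarrow> \<exists>F c. trig_poly D (of_real c) F \<and>
      (\<forall>x. 0 \<le> F x \<and> F x \<le> 1) \<and> (\<forall>x. dist_nearest_int x > 2 / N \<longrightarrow> F x \<le> K / real D) \<and>
      7 / (4 * N) * (1 - K / real D) \<le> c"
    using exists_trig_cutoff[of "7 / (4 * N)" "2 / N"] N by (auto simp: field_simps)
  \<comment> \<open>The second entry yields \<open>k * \<epsilon> = K / k \<le> 1 / (2 * N)\<close>;
    the first yields \<open>(3 / 2) ^ k \<ge> 2\<close>.\<close>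
  define k0 where "k0 = max 2 (nat \<lceil>2 * N * K\<rceil>)"
  have "real M / (real n * N ^ k) \<le> real (card (C_minus M u n (2 / N) k))"
    if k: "k \<ge> k0" and Mu: "\<forall>j\<in>{1..k}. real M * u j \<in> \<int>" and n: "n \<ge> 2" "n dvd M"
    and nonres: "\<forall>r::nat \<Rightarrow> int. (\<forall>j\<in>{1..k}. \<bar>r j\<bar> \<le> int (k\<^sup>2)) \<longrightarrow> (\<exists>j\<in>{1..k}. r j \<noteq> 0) \<longrightarrow>
      real n * (\<Sum>j=1..k. of_int (r j) * u j) \<notin> \<int>"
    for k M n and u :: "nat \<Rightarrow> real"
  proof -
    have k2: "k \<ge> 2" and kK: "2 * N * K \<le> real k" using k by (auto simp: k0_def nat_le_iff ceiling_le_iff)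
    \<comment> \<open>Degree \<open>k\<^sup>2\<close> leaves an error of order 1/k after the union
      bound over \<open>k\<close> indices.\<close>
    define \<epsilon> where "\<epsilon> = K / real (k\<^sup>2)"
    obtain F c where F: "trig_poly (k\<^sup>2) (of_real c) F" "\<And>x. 0 \<le> F x" "\<And>x. F x \<le> 1"
      "\<And>x. dist_nearest_int x > 2 / N \<Longrightarrow> F x \<le> \<epsilon>" and c: "7 / (4 * N) * (1 - \<epsilon>) \<le> c"
      using cutoff[of "k\<^sup>2"] k2 unfolding \<epsilon>_def by auto
    have k\<epsilon>: "real k * \<epsilon> \<le> 1 / (2 * N)"
      using kK k2 N by (simp add: \<epsilon>_def field_simps power2_eq_square)
    have \<epsilon>0: "0 \<le> \<epsilon>" using K by (simp add: \<epsilon>_def)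
    have "\<epsilon> \<le> real k * \<epsilon>" using \<epsilon>0 k2 by (simp add: mult_le_cancel_right1)
    also note k\<epsilon>
    also have "1 / (2 * N) \<le> 1 / 8" using N by (simp add: field_simps)
    finally have "\<epsilon> \<le> 1 / 8" .
    then have "7 / (4 * N) * (7 / 8) \<le> 7 / (4 * N) * (1 - \<epsilon>)"
      using N by (intro mult_left_mono) auto
    \<comment> \<open>Here 7/4 times 7/8 is 49/32, just above 3/2.\<close>
    with c have c32: "3 / 2 * (1 / N) \<le> c" using N by (simp add: field_simps)
    then have c0: "0 < c" using N by (smt (verit) divide_pos_pos mult_pos_pos)
    have "1 / (2 * N) = 1 / N / 2" "0 < 1 / N" using N by simp_all
    with k\<epsilon> c32 have "real k * \<epsilon> \<le> c / 2" by linarith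
    then have "real k * \<epsilon> * c ^ (k - 1) \<le> c / 2 * c ^ (k - 1)"
      using c0 by (intro mult_right_mono) auto
    also have "c / 2 * c ^ (k - 1) = c ^ k / 2" using k2 by (simp add: power_eq_if)
    finally have half: "c ^ k / 2 \<le> c ^ k - real k * \<epsilon> * c ^ (k - 1)" by simp
    \<comment> \<open>The surplus factor 3/2 per coordinate pays for the half of the main term lost
      to the error.\<close>
    have "(3 / 2 :: real) ^ 2 \<le> (3 / 2) ^ k" using k2 by (intro power_increasing) auto
    then have "2 * (1 / N) ^ k \<le> (3 / 2) ^ k * (1 / N) ^ k"
      using N by (intro mult_right_mono) (auto simp: power2_eq_square)
    also have "\<dots> = (3 / 2 * (1 / N)) ^ k" by (simp only: power_mult_distrib)
    also have "\<dots> \<le> c ^ k" using c32 N by (intro power_mono) auto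
    finally have pow: "1 / N ^ k \<le> c ^ k - real k * \<epsilon> * c ^ (k - 1)" using half by (simp add: power_divide)
    \<comment> \<open>\<open>n \<ge> 2\<close> makes the non-multiples of \<open>n\<close> at least
      as numerous as the multiples.\<close>
    have "real M / real n \<le> real M / 2" using n by (intro divide_left_mono) auto
    then have "real M / real n \<le> real M - real M / real n" by linarith
    then have "real M / real n * (1 / N ^ k) \<le> (real M - real M / real n) * (c ^ k - real k * \<epsilon> * c ^ (k - 1))"
      using pow N by (intro mult_mono) (auto intro: order_trans[rotated])
    also have "\<dots> \<le> real (card (C_minus M u n (2 / N) k))"
      using Mu nonres n by (intro card_C_minus_ge[OF F \<epsilon>0]) auto
    finally show ?thesis by simp
  qed
  then show ?thesis by blast
qed

section \<open>Small \<open>N\<close>, and the two ranges of \<open>N\<close> combined\<close>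

text \<open>Distances to the nearest integer never exceed 1/2, so only the condition modulo
  \<open>n\<close> remains.\<close>

lemma card_C_minus_half:
  assumes "\<eta> \<ge> 1 / 2" "n \<ge> 2" "n dvd M"
  shows "real M / real n \<le> real (card (C_minus M u n \<eta> k))"
proof -
  have "C_minus M u n \<eta> k = {l. l < M \<and> \<not> n dvd l}"
    using order_trans[OF dist_nearest_int_bounds(2) assms(1)] by (auto simp: C_minus_def cong_0_iff)
  then have "real (card (C_minus M u n \<eta> k)) = real M - real M / real n"
    using assms by (simp add: card_nonmultiples_below)
  moreover have "real M / real n \<le> real M / 2" using assms by (intro divide_left_mono) auto
  ultimately show ?thesis by linarith
qed

theorem theorem3:
  fixes N :: real
  assumes "N \<ge> 1"
  shows "\<exists>k\<^sub>0::nat. \<forall>k\<ge>k\<^sub>0. \<forall>(M::nat) (n::nat) (u::nat \<Rightarrow> real).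
           M > 0 \<and> (\<forall>j\<in>{1..k}. real M * u j \<in> \<int>) \<and> n \<ge> 2 \<and> n dvd M \<longrightarrow>
             (\<exists>r::nat \<Rightarrow> int.
                (\<exists>j\<in>{1..k}. r j \<noteq> 0) \<and>
                (\<forall>j\<in>{1..k}. \<bar>real_of_int (r j)\<bar> \<le> real k ^ 4 * N * (ln N)\<^sup>2) \<and>
                real n * (\<Sum>j=1..k. real_of_int (r j) * u j) \<in> \<int>) \<or>
             real (card (C_minus M u n (2 / N) k)) \<ge> real M / (real n * N ^ k)"
proof (cases "N > 4")
  case True
  from card_C_minus_ge_of_nonresonant[OF this]
  obtain k0 :: nat where k0: "\<forall>k\<ge>k0. \<forall>(M::nat) (n::nat) (u::nat \<Rightarrow> real).
    (\<forall>j\<in>{1..k}. real M * u j \<in> \<int>) \<and> n \<ge> 2 \<and> n dvd M \<and>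
    (\<forall>r::nat \<Rightarrow> int. (\<forall>j\<in>{1..k}. \<bar>r j\<bar> \<le> int (k\<^sup>2)) \<longrightarrow> (\<exists>j\<in>{1..k}. r j \<noteq> 0) \<longrightarrow>
      real n * (\<Sum>j=1..k. of_int (r j) * u j) \<notin> \<int>) \<longrightarrow>
    real M / (real n * N ^ k) \<le> real (card (C_minus M u n (2 / N) k))" ..
  \<comment> \<open>\<open>N > 4\<close> exceeds e, so \<open>ln N \<ge> 1\<close> and the degree
    \<open>k\<^sup>2\<close> stays within the bound required of \<open>r\<close>.\<close>
  have "exp 1 \<le> N" using exp_le True by linarith
  then have "1 \<le> ln N" using True by (simp add: ln_ge_iff)
  then have "1 * 1 \<le> N * (ln N)\<^sup>2" using True by (intro mult_mono) auto
  then have bound: "real (k\<^sup>2) \<le> real k ^ 4 * N * (ln N)\<^sup>2" for k :: nat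
  proof -
    have "real k ^ 2 \<le> real k ^ 4" by (cases "k = 0") (auto intro: power_increasing)
    also have "\<dots> = real k ^ 4 * 1" by simp
    also have "\<dots> \<le> real k ^ 4 * (N * (ln N)\<^sup>2)"
      using \<open>1 * 1 \<le> N * (ln N)\<^sup>2\<close> by (intro mult_left_mono) auto
    finally show ?thesis by (simp add: mult_ac)
  qed
  show ?thesis
  proof (intro exI[of _ k0] allI impI, elim conjE)
    fix k M n :: nat and u :: "nat \<Rightarrow> real"
    assume k: "k0 \<le> k" and Mu: "\<forall>j\<in>{1..k}. real M * u j \<in> \<int>" and n: "2 \<le> n" "n dvd M"
    show "(\<exists>r::nat \<Rightarrow> int. (\<exists>j\<in>{1..k}. r j \<noteq> 0) \<and>
                (\<forall>j\<in>{1..k}. \<bar>real_of_int (r j)\<bar> \<le> real k ^ 4 * N * (ln N)\<^sup>2) \<and>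
                real n * (\<Sum>j=1..k. real_of_int (r j) * u j) \<in> \<int>) \<or>
             real (card (C_minus M u n (2 / N) k)) \<ge> real M / (real n * N ^ k)"
    proof (rule disjCI)
      assume no: "\<not> real (card (C_minus M u n (2 / N) k)) \<ge> real M / (real n * N ^ k)"
      then obtain r :: "nat \<Rightarrow> int" where r: "\<forall>j\<in>{1..k}. \<bar>r j\<bar> \<le> int (k\<^sup>2)" "\<exists>j\<in>{1..k}. r j \<noteq> 0"
        "real n * (\<Sum>j=1..k. of_int (r j) * u j) \<in> \<int>"
        using k0[rule_format, OF k, of M u n] Mu n by blast
      have "\<bar>real_of_int (r j)\<bar> \<le> real k ^ 4 * N * (ln N)\<^sup>2" if "j \<in> {1..k}" for j
      proof -
        have "\<bar>real_of_int (r j)\<bar> = real_of_int \<bar>r j\<bar>" by simp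
        also have "\<dots> \<le> real_of_int (int (k\<^sup>2))" using r(1) that by (simp only: of_int_le_iff)
        also have "\<dots> \<le> real k ^ 4 * N * (ln N)\<^sup>2" using bound[of k] by simp
        finally show ?thesis .
      qed
      with r show "\<exists>r::nat \<Rightarrow> int. (\<exists>j\<in>{1..k}. r j \<noteq> 0) \<and>
                (\<forall>j\<in>{1..k}. \<bar>real_of_int (r j)\<bar> \<le> real k ^ 4 * N * (ln N)\<^sup>2) \<and>
                real n * (\<Sum>j=1..k. real_of_int (r j) * u j) \<in> \<int>"
        by blast
    qed
  qed
next
  case False
  show ?thesis
  \<comment> \<open>For \<open>N \<le> 4\<close> one has \<open>2 / N \<ge> 1 / 2\<close>, so the
    second alternative holds for every \<open>k\<close>.\<close>
  proof (intro exI[of _ 0] allI impI disjI2, elim conjE)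
    fix k M n :: nat and u :: "nat \<Rightarrow> real"
    assume n: "2 \<le> n" "n dvd M"
    have "1 \<le> N ^ k" using assms by (rule one_le_power)
    then have "real n * 1 \<le> real n * N ^ k" by (intro mult_left_mono) auto
    then have "real M / (real n * N ^ k) \<le> real M / (real n * 1)"
      using n assms by (intro divide_left_mono mult_pos_pos) auto
    also have "\<dots> \<le> real (card (C_minus M u n (2 / N) k))"
      using card_C_minus_half[of "2 / N" n M u k] n False assms by (simp add: field_simps)
    finally show "real (card (C_minus M u n (2 / N) k)) \<ge> real M / (real n * N ^ k)" .
  qed
qed

end
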